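(* Let $A=R/I$ be a one-dimensional Gorenstein graded $\mathbf k$-algebra ($I$ a homogeneous ideal of $R$), whose inverse system $I^\perp$ contains a set $\mathcal F=\{F_l\}_{l\in\mathbb N_+}$. Let $z\in R$ be a linear form which is a non-zero divisor of $A$. Suppose that $\mathcal F$ satisfies the following conditions: (1) for all $l\in\mathbb N_+$, $z\circ F_l=F_{l-1}$ if $l>1$, and $z\circ F_1=0$; (2) $\deg(F_1)$ agrees with the socle degree of $A$. Then there exist non-zero elements $\alpha_l\in\mathbf k^*$, $l\in\mathbb N_+$, such that $\mathcal F'=\{\frac1{\alpha_l}F_l;\ l\in\mathbb N_+\}$ is $G$-admissible with respect to $z$; in particular $\mathcal F$ (and $\mathcal F'$) is a system of generators of $I^\perp$.
   Context: $\mathbf k$ is an algebraically closed field of characteristic zero, $R=\mathbf k[x_1,\dots,x_n]$ (standard graded) and $\Gamma=\mathbf k[y_1,\dots,y_n]$. $R$ acts on $\Gamma$ by differentiation: $f\circ g=f(\partial_{y_1},\dots,\partial_{y_n})(g)$, making $\Gamma$ an $R$-module. $\langle G_j\rangle$ denotes the $R$-submodule of $\Gamma$ generated by elements $G_j$. The inverse system of an ideal $I\subset R$ is $I^\perp=\{G\in\Gamma: I\circ G=0\}$; for a submodule $W\subset\Gamma$, $\operatorname{Ann}_R(W)=\{g\in R: g\circ G=0\ \forall G\in W\}$. The socle degree of a one-dimensional Gorenstein graded algebra $A$ is the largest $t$ with $(A/zA)_t\ne0$, for $z$ a linear non-zero divisor of $A$ (it does not depend on $z$). A family $\{F_l\}_{l\in\mathbb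 N_+}$ in $\Gamma$ is $G$-admissible with respect to a linear form $z\in R$ if: (1) $z\circ F_l=F_{l-1}$ for $l>1$ and $z\circ F_1=0$; (2) $\operatorname{Ann}_R(\langle F_l\rangle)\circ F_{l+1}=\langle F_1\rangle$ for all $l\in\mathbb N_+$. *)

theory Defs
  imports "HOL-Library.Poly_Mapping" "HOL-Computational_Algebra.Polynomial"
begin

section \<open>Polynomials in finitely many variables\<close>

text \<open>
  The variables are indexed by a finite type \<open>'n\<close>, so that \<open>n = CARD('n)\<close>. The same type serves
  for \<open>R = k[x\<^sub>1,\<dots>,x\<^sub>n]\<close> and, as a \<open>k\<close>-vector space, for \<open>\<Gamma> = k[y\<^sub>1,\<dots>,y\<^sub>n]\<close>. The quotient
  \<open>A = R/I\<close> is represented by \<open>I\<close>, and notions about \<open>A\<close> are read off on representatives in \<open>R\<close>.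
\<close>

type_synonym 'n monom = "'n \<Rightarrow>\<^sub>0 nat"

type_synonym ('n, 'a) mpoly = "('n \<Rightarrow>\<^sub>0 nat) \<Rightarrow>\<^sub>0 'a"

definition mvar :: "'n \<Rightarrow> ('n, 'a::comm_ring_1) mpoly"
  where "mvar i = Poly_Mapping.single (Poly_Mapping.single i 1) 1"

definition mscale :: "'a \<Rightarrow> ('n, 'a::comm_ring_1) mpoly \<Rightarrow> ('n, 'a) mpoly"
  where "mscale c p = Poly_Mapping.single 0 c * p"

definition mdeg :: "('n::finite) monom \<Rightarrow> nat"
  where "mdeg m = (\<Sum>i\<in>UNIV. Poly_Mapping.lookup m i)"

text \<open>The zero polynomial has no degree, and it is homogeneous of every degree.\<close>

definition has_degree :: "('n::finite, 'a::comm_ring_1) mpoly \<Rightarrow> nat \<Rightarrow> bool"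
  where "has_degree p d \<longleftrightarrow> (\<exists>m\<in>Poly_Mapping.keys p. mdeg m = d) \<and> (\<forall>m\<in>Poly_Mapping.keys p. mdeg m \<le> d)"

definition homogeneous :: "nat \<Rightarrow> ('n::finite, 'a::comm_ring_1) mpoly \<Rightarrow> bool"
  where "homogeneous d p \<longleftrightarrow> (\<forall>m\<in>Poly_Mapping.keys p. mdeg m = d)"

abbreviation linear_form :: "('n::finite, 'a::comm_ring_1) mpoly \<Rightarrow> bool"
  where "linear_form \<equiv> homogeneous 1"


section \<open>Ideals and quotients\<close>

abbreviation is_ideal :: "'r::comm_ring_1 set \<Rightarrow> bool"
  where "is_ideal \<equiv> module.subspace (*)"

abbreviation ideal_gen :: "'r::comm_ring_1 set \<Rightarrow> 'r set"
  where "ideal_gen \<equiv> module.span (*)"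

global_interpretation ideal: module "(*) :: 'r::comm_ring_1 \<Rightarrow> 'r \<Rightarrow> 'r"
  by standard (simp_all add: algebra_simps)

definition homogeneous_ideal :: "('n::finite, 'a::comm_ring_1) mpoly set \<Rightarrow> bool"
  where "homogeneous_ideal I \<longleftrightarrow> (\<exists>S. (\<forall>p\<in>S. \<exists>d. homogeneous d p) \<and> I = ideal_gen S)"

definition prime_ideal :: "'r::comm_ring_1 set \<Rightarrow> bool"
  where "prime_ideal P \<longleftrightarrow>
    is_ideal P \<and> 1 \<notin> P \<and> (\<forall>a b. a * b \<in> P \<longrightarrow> a \<in> P \<or> b \<in> P)"

text \<open>The prime ideals of \<open>R/I\<close> correspond to the prime ideals of \<open>R\<close> that contain \<open>I\<close>.\<close>

definition prime_chain :: "'r::comm_ring_1 set \<Rightarrow> nat \<Rightarrow> (nat \<Rightarrow> 'r set) \<Rightarrow> bool"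
  where "prime_chain I d P \<longleftrightarrow>
    (\<forall>i\<le>d. prime_ideal (P i) \<and> I \<subseteq> P i) \<and> (\<forall>i<d. P i \<subset> P (Suc i))"

definition quot_krull_dim :: "'r::comm_ring_1 set \<Rightarrow> nat \<Rightarrow> bool"
  where "quot_krull_dim I d \<longleftrightarrow>
    (\<exists>P. prime_chain I d P) \<and> (\<forall>e P. prime_chain I e P \<longrightarrow> e \<le> d)"

definition quot_nonzerodiv :: "'r::comm_ring_1 set \<Rightarrow> 'r \<Rightarrow> bool"
  where "quot_nonzerodiv I z \<longleftrightarrow> (\<forall>g. z * g \<in> I \<longrightarrow> g \<in> I)"

definition quot_regular_seq :: "'r::comm_ring_1 set \<Rightarrow> 'r list \<Rightarrow> bool"
  where "quot_regular_seq I ts \<longleftrightarrow>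
    (\<forall>i<length ts. quot_nonzerodiv (ideal_gen (I \<union> set (take i ts))) (ts ! i)) \<and>
    ideal_gen (I \<union> set ts) \<noteq> UNIV"

text \<open>\<open>quot_socle J\<close> is the preimage in \<open>R\<close> of the socle of \<open>R/J\<close>, that is of \<open>0 : m\<close>, where \<open>m\<close>
  is the homogeneous maximal ideal.\<close>

definition quot_socle :: "('n::finite, 'a::field) mpoly set \<Rightarrow> ('n, 'a) mpoly set"
  where "quot_socle J = {f. \<forall>i. mvar i * f \<in> J}"

definition one_dim_socle :: "('n::finite, 'a::field) mpoly set \<Rightarrow> bool"
  where "one_dim_socle J \<longleftrightarrow>
    (\<exists>h\<in>quot_socle J. h \<notin> J \<and> (\<forall>f\<in>quot_socle J. \<exists>c. f - mscale c h \<in> J))"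

text \<open>
  A graded algebra \<open>R/I\<close> is Gorenstein if it is Cohen-Macaulay of type one: some regular sequence of
  homogeneous elements of positive degree has length \<open>dim R/I\<close>, and the quotient by it has a
  one-dimensional socle. The dimension of this socle does not depend on the sequence.
\<close>

definition quot_gorenstein :: "('n::finite, 'a::field) mpoly set \<Rightarrow> bool"
  where "quot_gorenstein I \<longleftrightarrow>
    (\<exists>ts. quot_krull_dim I (length ts) \<and> quot_regular_seq I ts \<and>
          (\<forall>t\<in>set ts. \<exists>e>0. homogeneous e t) \<and>
          one_dim_socle (ideal_gen (I \<union> set ts)))"

definition quot_component_nonzero :: "('n::finite, 'a::field) mpoly set \<Rightarrow> nat \<Rightarrow> bool"
  where "quot_component_nonzero J t \<longleftrightarrow> (\<exists>f. homogeneous t f \<and> f \<notin> J)"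

definition is_socle_degree :: "('n::finite, 'a::field) mpoly set \<Rightarrow> nat \<Rightarrow> bool"
  where "is_socle_degree I s \<longleftrightarrow>
    (\<exists>z. linear_form z \<and> quot_nonzerodiv I z \<and>
         quot_component_nonzero (ideal_gen (insert z I)) s \<and>
         (\<forall>t. quot_component_nonzero (ideal_gen (insert z I)) t \<longrightarrow> t \<le> s))"


section \<open>The action by differentiation\<close>

definition partial_deriv :: "'n \<Rightarrow> ('n, 'a::comm_ring_1) mpoly \<Rightarrow> ('n, 'a) mpoly"
  where "partial_deriv i g =
    (\<Sum>m\<in>Poly_Mapping.keys g. Poly_Mapping.single (m - Poly_Mapping.single i 1) (of_nat (Poly_Mapping.lookup m i) * Poly_Mapping.lookup g m))"

text \<open>The composition of the \<open>a\<^sub>i\<close>-fold iterates of the partial derivatives, which commute.\<close>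

definition monom_deriv :: "('n::finite) monom \<Rightarrow> ('n, 'a::comm_ring_1) mpoly \<Rightarrow> ('n, 'a) mpoly"
  where "monom_deriv a g = Finite_Set.fold (\<lambda>i. partial_deriv i ^^ Poly_Mapping.lookup a i) g UNIV"

definition dact :: "('n::finite, 'a::comm_ring_1) mpoly \<Rightarrow> ('n, 'a) mpoly \<Rightarrow> ('n, 'a) mpoly"
    (infixr \<open>\<odot>\<close> 75)
  where "f \<odot> g = (\<Sum>a\<in>Poly_Mapping.keys f. mscale (Poly_Mapping.lookup f a) (monom_deriv a g))"

lemma lookup_mscale: "Poly_Mapping.lookup (mscale c p) m = c * Poly_Mapping.lookup p m"
  unfolding mscale_def mult_map_scale_conv_mult[symmetric]
  by (simp add: Poly_Mapping.map.rep_eq when_def)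

lemma lookup_partial_deriv:
  "Poly_Mapping.lookup (partial_deriv i g) m =
     of_nat (Suc (Poly_Mapping.lookup m i)) * Poly_Mapping.lookup g (m + Poly_Mapping.single i 1)"
proof -
  let ?e = "Poly_Mapping.single i (1::nat)"
  have "Poly_Mapping.lookup (partial_deriv i g) m =
      (\<Sum>k\<in>Poly_Mapping.keys g. (of_nat (Poly_Mapping.lookup k i) * Poly_Mapping.lookup g k when k - ?e = m))"
    by (simp add: partial_deriv_def lookup_sum lookup_single)
  also have "\<dots> = (\<Sum>k\<in>Poly_Mapping.keys g. if k = m + ?e then of_nat (Poly_Mapping.lookup k i) * Poly_Mapping.lookup g k else 0)"
  proof (intro sum.cong refl)
    fix k assume "k \<in> Poly_Mapping.keys g"
    show "(of_nat (Poly_Mapping.lookup k i) * Poly_Mapping.lookup g k when k - ?e = m) =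
        (if k = m + ?e then of_nat (Poly_Mapping.lookup k i) * Poly_Mapping.lookup g k else 0)"
    proof (cases "Poly_Mapping.lookup k i = 0")
      case False
      have "k - ?e = m \<longleftrightarrow> k = m + ?e"
      proof
        assume m: "k - ?e = m"
        show "k = m + ?e"
          unfolding m[symmetric] using False
          by (intro poly_mapping_eqI) (auto simp: lookup_add lookup_minus lookup_single when_def)
      qed auto
      then show ?thesis by (simp add: when_def)
    qed (auto simp: when_def)
  qed
  also have "\<dots> = of_nat (Suc (Poly_Mapping.lookup m i)) * Poly_Mapping.lookup g (m + ?e)"
    by (auto simp: sum.delta lookup_add in_keys_iff)
  finally show ?thesis .
qed

lemma comp_fun_commute_partial_deriv:
  "comp_fun_commute (partial_deriv :: 'n \<Rightarrow> ('n, 'a::comm_ring_1) mpoly \<Rightarrow> _)"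
proof
  fix i j :: 'n
  show "partial_deriv j \<circ> partial_deriv i =
    (partial_deriv i \<circ> partial_deriv j :: ('n, 'a) mpoly \<Rightarrow> _)"
  proof
    fix g :: "('n, 'a) mpoly"
    show "(partial_deriv j \<circ> partial_deriv i) g = (partial_deriv i \<circ> partial_deriv j) g"
    proof (cases "i = j")
      case False
      then have "Poly_Mapping.lookup (Poly_Mapping.single i (1::nat)) j = 0"
          "Poly_Mapping.lookup (Poly_Mapping.single j (1::nat)) i = 0"
        by (simp_all add: lookup_single)
      then show ?thesis
        by (intro poly_mapping_eqI)
          (simp only: o_apply lookup_partial_deriv lookup_add add_0_left add_0_right mult_ac add_ac)
    qed simp
  qed
qed

lemma lookup_partial_deriv_funpow:
  "Poly_Mapping.lookup ((partial_deriv i ^^ k) g) m =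
     pochhammer (of_nat (Suc (Poly_Mapping.lookup m i))) k * Poly_Mapping.lookup g (m + Poly_Mapping.single i k)"
proof (induction k arbitrary: m)
  case (Suc k)
  have "Poly_Mapping.lookup ((partial_deriv i ^^ Suc k) g) m =
      of_nat (Suc (Poly_Mapping.lookup m i)) * (pochhammer (of_nat (Suc (Suc (Poly_Mapping.lookup m i)))) k *
        Poly_Mapping.lookup g (m + Poly_Mapping.single i 1 + Poly_Mapping.single i k))"
    by (simp add: lookup_partial_deriv Suc lookup_add)
  also have "m + Poly_Mapping.single i 1 + Poly_Mapping.single i k =
      m + Poly_Mapping.single i (Suc k)"
    by (simp add: add.assoc single_add[symmetric])
  also have "of_nat (Suc (Poly_Mapping.lookup m i)) * (pochhammer (of_nat (Suc (Suc (Poly_Mapping.lookup m i)))) k *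
        Poly_Mapping.lookup g (m + Poly_Mapping.single i (Suc k))) =
      pochhammer (of_nat (Suc (Poly_Mapping.lookup m i))) (Suc k) * Poly_Mapping.lookup g (m + Poly_Mapping.single i (Suc k))"
    by (simp only: pochhammer_rec of_nat_Suc mult.assoc add_ac)
  finally show ?case .
qed simp

lemma monom_eq_sum_single:
  fixes a :: "('n::finite) monom"
  shows "(\<Sum>i\<in>UNIV. Poly_Mapping.single i (Poly_Mapping.lookup a i)) = a"
  by (intro poly_mapping_eqI) (simp add: lookup_sum lookup_single when_def)

lemma lookup_monom_deriv:
  fixes g :: "('n::finite, 'a::comm_ring_1) mpoly"
  shows "Poly_Mapping.lookup (monom_deriv a g) m =
    (\<Prod>i\<in>UNIV. pochhammer (of_nat (Suc (Poly_Mapping.lookup m i))) (Poly_Mapping.lookup a i)) * Poly_Mapping.lookup g (m + a)"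
proof -
  let ?f = "\<lambda>i. (partial_deriv i :: ('n, 'a) mpoly \<Rightarrow> _) ^^ Poly_Mapping.lookup a i"
  interpret comp_fun_commute ?f
    by (rule comp_fun_commute.comp_fun_commute_funpow[OF comp_fun_commute_partial_deriv])
  have "Poly_Mapping.lookup (Finite_Set.fold ?f g A) m =
      (\<Prod>i\<in>A. pochhammer (of_nat (Suc (Poly_Mapping.lookup m i))) (Poly_Mapping.lookup a i)) *
      Poly_Mapping.lookup g (m + (\<Sum>i\<in>A. Poly_Mapping.single i (Poly_Mapping.lookup a i)))" if "finite A" for A
    using that
  proof (induction A arbitrary: m rule: finite_induct)
    case (insert x A)
    have *: "(\<Prod>i\<in>A. pochhammer (of_nat (Suc (Poly_Mapping.lookup (m + Poly_Mapping.single x (Poly_Mapping.lookup a x)) i)))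
          (Poly_Mapping.lookup a i)) =
        (\<Prod>i\<in>A. pochhammer (of_nat (Suc (Poly_Mapping.lookup m i)) :: 'a) (Poly_Mapping.lookup a i))"
      using insert.hyps by (intro prod.cong refl) (auto simp: lookup_add lookup_single when_def)
    have "Poly_Mapping.lookup (Finite_Set.fold ?f g (insert x A)) m =
        Poly_Mapping.lookup (?f x (Finite_Set.fold ?f g A)) m"
      by (simp only: fold_insert[OF insert.hyps])
    also have "\<dots> = pochhammer (of_nat (Suc (Poly_Mapping.lookup m x))) (Poly_Mapping.lookup a x) *
        Poly_Mapping.lookup (Finite_Set.fold ?f g A) (m + Poly_Mapping.single x (Poly_Mapping.lookup a x))"
      by (rule lookup_partial_deriv_funpow)
    also note insert.IH
    also note *
    finally show ?case
      by (simp only: prod.insert[OF insert.hyps] sum.insert[OF insert.hyps] mult.assoc add.assoc)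
  qed simp
  from this[OF finite_UNIV] show ?thesis
    by (simp add: monom_deriv_def monom_eq_sum_single)
qed

lemma lookup_dact:
  assumes "finite K" "Poly_Mapping.keys f \<subseteq> K"
  shows "Poly_Mapping.lookup (f \<odot> g) m = (\<Sum>a\<in>K. Poly_Mapping.lookup f a * Poly_Mapping.lookup (monom_deriv a g) m)"
  unfolding dact_def lookup_sum lookup_mscale
  using assms by (intro sum.mono_neutral_left) (auto simp: in_keys_iff)

lemma monom_deriv_add: "monom_deriv a (g + h) = monom_deriv a g + monom_deriv a h"
  by (intro poly_mapping_eqI) (simp add: lookup_monom_deriv lookup_add algebra_simps)

lemma monom_deriv_mscale: "monom_deriv a (mscale c g) = mscale c (monom_deriv a g)"
  by (intro poly_mapping_eqI) (simp only: lookup_monom_deriv lookup_mscale mult.left_commute)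

lemma monom_deriv_monom_deriv:
  fixes g :: "('n::finite, 'a::comm_ring_1) mpoly"
  shows "monom_deriv a (monom_deriv b g) = monom_deriv (a + b) g"
proof (rule poly_mapping_eqI)
  fix m
  have "pochhammer (of_nat (Suc k)) (i + j) =
      pochhammer (of_nat (Suc k)) i * (pochhammer (of_nat (Suc (k + i))) j :: 'a)" for i j k
    by (simp only: pochhammer_product' of_nat_Suc of_nat_add add.assoc)
  then show "Poly_Mapping.lookup (monom_deriv a (monom_deriv b g)) m =
      Poly_Mapping.lookup (monom_deriv (a + b) g) m"
    by (simp only: lookup_monom_deriv lookup_add prod.distrib mult.assoc add.assoc)
qed

lemma dact_add_right: "f \<odot> (g + h) = f \<odot> g + f \<odot> h"
  by (simp add: dact_def monom_deriv_add mscale_def algebra_simps sum.distrib)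

lemma dact_add_left: "(f + g) \<odot> h = f \<odot> h + g \<odot> h"
proof (rule poly_mapping_eqI)
  fix m
  let ?K = "Poly_Mapping.keys f \<union> Poly_Mapping.keys g"
  have "Poly_Mapping.keys (f + g) \<subseteq> ?K" by (rule keys_add)
  then show "Poly_Mapping.lookup ((f + g) \<odot> h) m = Poly_Mapping.lookup (f \<odot> h + g \<odot> h) m"
    by (simp add: lookup_add lookup_dact[where K = ?K] algebra_simps sum.distrib)
qed

lemma dact_zero_left [simp]: "0 \<odot> g = 0"
  by (simp add: dact_def)

lemma dact_zero_right [simp]: "f \<odot> 0 = 0"
  using dact_add_right[of f 0 0] by simp

lemma dact_sum_left: "(\<Sum>x\<in>X. f x) \<odot> g = (\<Sum>x\<in>X. f x \<odot> g)"
  by (induction X rule: infinite_finite_induct) (simp_all add: dact_add_left)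

lemma dact_sum_right: "f \<odot> (\<Sum>x\<in>X. g x) = (\<Sum>x\<in>X. f \<odot> g x)"
  by (induction X rule: infinite_finite_induct) (simp_all add: dact_add_right)

lemma dact_single: "Poly_Mapping.single a c \<odot> g = mscale c (monom_deriv a g)"
  by (cases "c = 0") (simp_all add: dact_def mscale_def)

lemma mpoly_eq_sum_single: "p = (\<Sum>a\<in>Poly_Mapping.keys p. Poly_Mapping.single a (Poly_Mapping.lookup p a))"
  by (intro poly_mapping_eqI) (auto simp: lookup_sum lookup_single when_def in_keys_iff)

lemma dact_dact: "f \<odot> (g \<odot> h) = (f * g) \<odot> h"
proof -
  have *: "Poly_Mapping.single a c \<odot> (Poly_Mapping.single b d \<odot> h) =
      (Poly_Mapping.single a c * Poly_Mapping.single b d) \<odot> h" for a b c d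
    unfolding dact_single mult_single monom_deriv_mscale monom_deriv_monom_deriv
    by (intro poly_mapping_eqI) (simp only: lookup_mscale mult.assoc)
  let ?f = "\<Sum>a\<in>Poly_Mapping.keys f. Poly_Mapping.single a (Poly_Mapping.lookup f a)"
  let ?g = "\<Sum>a\<in>Poly_Mapping.keys g. Poly_Mapping.single a (Poly_Mapping.lookup g a)"
  have "?f \<odot> (?g \<odot> h) = (?f * ?g) \<odot> h"
    by (simp only: dact_sum_left dact_sum_right * sum_product) (rule sum.swap)
  then show ?thesis unfolding mpoly_eq_sum_single[symmetric] .
qed

lemma dact_one: "1 \<odot> g = g"
proof -
  have "Poly_Mapping.single 0 1 \<odot> g = g"
    unfolding dact_single by (intro poly_mapping_eqI) (simp add: lookup_mscale lookup_monom_deriv)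
  then show ?thesis by simp
qed

lemma dact_mvar:
  fixes g :: "('n::finite, 'a::comm_ring_1) mpoly"
  shows "mvar i \<odot> g = partial_deriv i g"
proof (rule poly_mapping_eqI)
  fix m
  have "(\<Prod>j\<in>UNIV. pochhammer (of_nat (Suc (Poly_Mapping.lookup m j)))
        (Poly_Mapping.lookup (Poly_Mapping.single i (1::nat)) j)) =
      (\<Prod>j\<in>UNIV. if j = i then of_nat (Suc (Poly_Mapping.lookup m j)) else 1 :: 'a)"
    by (intro prod.cong refl) (auto simp: lookup_single when_def)
  then show "Poly_Mapping.lookup (mvar i \<odot> g) m = Poly_Mapping.lookup (partial_deriv i g) m"
    unfolding mvar_def dact_single lookup_mscale lookup_monom_deriv lookup_partial_deriv
    by (simp only: mult_1 prod.delta finite_UNIV UNIV_I if_True)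
qed

global_interpretation dact: module "dact :: ('n::finite, 'a::comm_ring_1) mpoly \<Rightarrow> _"
  by standard (simp_all add: dact_add_left dact_add_right dact_dact dact_one)


section \<open>Inverse systems\<close>

abbreviation submodule_gen :: "('n::finite, 'a::comm_ring_1) mpoly set \<Rightarrow> ('n, 'a) mpoly set"
  where "submodule_gen \<equiv> module.span dact"

definition inverse_system :: "('n::finite, 'a::comm_ring_1) mpoly set \<Rightarrow> ('n, 'a) mpoly set"
  where "inverse_system I = {G. \<forall>f\<in>I. f \<odot> G = 0}"

definition Ann :: "('n::finite, 'a::comm_ring_1) mpoly set \<Rightarrow> ('n, 'a) mpoly set"
  where "Ann W = {g. \<forall>G\<in>W. g \<odot> G = 0}"

text \<open>Families indexed by the positive integers are functions on \<open>nat\<close> whose value at \<open>0\<close> is ignored.\<close>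

definition G_admissible ::
    "('n::finite, 'a::comm_ring_1) mpoly \<Rightarrow> (nat \<Rightarrow> ('n, 'a) mpoly) \<Rightarrow> bool"
  where "G_admissible z F \<longleftrightarrow>
    (\<forall>l>1. z \<odot> F l = F (l - 1)) \<and> z \<odot> F 1 = 0 \<and>
    (\<forall>l\<ge>1. (\<lambda>g. g \<odot> F (l + 1)) ` Ann (submodule_gen {F l}) = submodule_gen {F 1})"

end

theory Submission
  imports Defs
begin

text \<open>
  All \<open>\<alpha>\<^sub>l\<close> can be taken to be \<open>1\<close>. Put \<open>J = I + (z)\<close>. Comparing multiplication by two linear
  non-zero divisors on the finite-dimensional components of \<open>R/I\<close> shows that \<open>R/J\<close> vanishes above
  degree \<open>s\<close>, and for two non-zero divisors \<open>t, z\<close> of positive degree the relation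
  \<open>z a \<equiv> t b (mod I)\<close> is an isomorphism between the socles of \<open>R/(I + (t))\<close> and \<open>R/J\<close>. Hence \<open>R/J\<close>
  has a one-dimensional socle which contains its component of degree \<open>s\<close>. An element that kills
  \<open>F\<^sub>1\<close> but is not in \<open>J\<close> has a multiple spanning the socle, so all of \<open>R\<^sub>s\<close> would kill \<open>F\<^sub>1\<close>,
  contradicting \<open>deg F\<^sub>1 = s\<close>. Thus \<open>Ann F\<^sub>1 = J\<close>, and by duality \<open>J\<^sup>\<bottom> = \<langle>F\<^sub>1\<rangle>\<close>. Induction on \<open>l\<close> gives
  \<open>Ann F\<^sub>l = I + (z\<^sup>l)\<close> and \<open>(I + (z\<^sup>l))\<^sup>\<bottom> = \<langle>F\<^sub>l\<rangle>\<close>, from which everything follows because every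
  polynomial is killed by a power of \<open>z\<close>.
\<close>

\<comment> \<open>As rewrite rules these loop with \<open>mult.assoc\<close> and with the reversed \<open>dact_dact\<close>.\<close>
declare ideal.scale_scale [simp del] dact.scale_scale [simp del]


section \<open>Linear algebra\<close>

lemma (in vector_space) injective_on_span_finite_imp_surjective:
  assumes lin: "Vector_Spaces.linear scale scale \<phi>"
    and D: "finite D" "independent D"
    and into: "\<phi> ` span D \<subseteq> span D"
    and inj: "\<And>x. x \<in> span D \<Longrightarrow> \<phi> x = 0 \<Longrightarrow> x = 0"
  shows "span D \<subseteq> \<phi> ` span D"
proof
  interpret \<phi>: Vector_Spaces.linear scale scale \<phi> by (rule lin)
  have inj': "inj_on \<phi> (span D)"
    by (rule inj_onI) (metis inj \<phi>.diff right_minus_eq span_diff)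
  have ind: "independent (\<phi> ` D)"
    using D(2) inj' by (rule \<phi>.independent_injective_image)
  have card: "card (\<phi> ` D) = card D"
    using inj' span_superset by (intro card_image) (rule inj_on_subset)
  fix w assume w: "w \<in> span D"
  show "w \<in> \<phi> ` span D"
  proof (rule ccontr)
    assume "w \<notin> \<phi> ` span D"
    then have nw: "w \<notin> span (\<phi> ` D)" by (simp add: \<phi>.span_image)
    then have "independent (insert w (\<phi> ` D))"
      using ind by (rule independent_insertI)
    moreover have "insert w (\<phi> ` D) \<subseteq> span D"
      using w into span_superset[of D] by blast
    ultimately have "card (insert w (\<phi> ` D)) \<le> card D"
      using independent_span_bound[OF D(1)] by blast
    moreover have "w \<notin> \<phi> ` D" using nw span_base by blast
    ultimately show False using D(1) card by simp
  qed
qed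

text \<open>If \<open>h\<close> is a linear section of \<open>f\<close> modulo \<open>K\<close> that vanishes on \<open>K \<inter> W\<close>, then
  \<open>x \<mapsto> x - f (h x) + g (h x)\<close> is an injective endomorphism of \<open>W\<close>, hence onto.\<close>

lemma (in vector_space) surjective_mod_subspace:
  assumes f: "Vector_Spaces.linear scale scale f" and g: "Vector_Spaces.linear scale scale g"
    and V: "subspace V" and W: "subspace W" and K: "subspace K"
    and T: "finite T" "W \<subseteq> span T"
    and fW: "\<And>v. v \<in> V \<Longrightarrow> f v \<in> W" and gW: "\<And>v. v \<in> V \<Longrightarrow> g v \<in> W"
    and ker: "\<And>v. v \<in> V \<Longrightarrow> g v \<in> K \<Longrightarrow> f v \<in> K"
    and onto: "\<And>w. w \<in> W \<Longrightarrow> \<exists>v\<in>V. w - f v \<in> K"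
    and w: "w \<in> W"
  shows "\<exists>v\<in>V. w - g v \<in> K"
proof -
  interpret f: Vector_Spaces.linear scale scale f by (rule f)
  interpret g: Vector_Spaces.linear scale scale g by (rule g)
  interpret vector_space_pair scale scale ..
  obtain C where C: "C \<subseteq> K \<inter> W" "independent C" "K \<inter> W \<subseteq> span C"
    by (rule maximal_independent_subset)
  have "C \<subseteq> W" using C(1) by blast
  then obtain D where D: "C \<subseteq> D" "D \<subseteq> W" "independent D" "W \<subseteq> span D"
    using C(2) by (rule maximal_independent_subset_extend)
  have spanD: "span D = W" using D(2,4) W by (rule span_subspace)
  have finD: "finite D"
    using independent_span_bound[OF T(1) D(3)] D(2) T(2) by blast
  obtain r where r: "\<And>w. w \<in> W \<Longrightarrow> r w \<in> V \<and> w - f (r w) \<in> K"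
    using onto by metis
  obtain h where h: "Vector_Spaces.linear scale scale h"
    and h_basis: "\<And>d. d \<in> D \<Longrightarrow> h d = (if d \<in> C then 0 else r d)"
    using linear_independent_extend[OF D(3), of "\<lambda>d. if d \<in> C then 0 else r d"] by blast
  interpret h: Vector_Spaces.linear scale scale h by (rule h)
  have hV: "h x \<in> V" and hK: "x - f (h x) \<in> K" if "x \<in> W" for x
  proof -
    have "x \<in> span D" using that spanD by simp
    then have "h x \<in> V \<and> x - f (h x) \<in> K"
    proof (induction rule: span_induct_alt)
      case base
      show ?case using V K by (simp add: subspace_0 h.zero f.zero)
    next
      case (step c x y)
      have "h x \<in> V \<and> x - f (h x) \<in> K"
        using step(1) C(1) D(2) r[of x] V K
        by (auto simp: h_basis subspace_0 f.zero)
      moreover have "c *s x + y - f (h (c *s x + y)) = c *s (x - f (h x)) + (y - f (h y))"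
        by (simp add: h.add h.scale f.add f.scale scale_right_diff_distrib)
      ultimately have "c *s x + y - f (h (c *s x + y)) \<in> K"
        using step(2) K by (simp only: subspace_add subspace_scale)
      moreover have "h (c *s x + y) \<in> V"
        using \<open>h x \<in> V \<and> x - f (h x) \<in> K\<close> step(2) V by (simp add: h.add h.scale subspace_add subspace_scale)
      ultimately show ?case by blast
    qed
    then show "h x \<in> V" "x - f (h x) \<in> K" by auto
  qed
  have h0: "h x = 0" if "x \<in> span C" for x
    using that
  proof (induction rule: span_induct_alt)
    case (step c x y)
    then show ?case using D(1) h_basis[of x] by (auto simp: h.add h.scale)
  qed (rule h.zero)
  define \<phi> where "\<phi> = (\<lambda>x. x - f (h x) + g (h x))"
  have lin: "Vector_Spaces.linear scale scale \<phi>"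
    by unfold_locales
      (simp_all add: \<phi>_def h.add h.scale f.add f.scale g.add g.scale
        scale_right_diff_distrib scale_right_distrib)
  have "\<phi> ` span D \<subseteq> span D"
    unfolding spanD \<phi>_def using hV fW gW W by (auto intro!: subspace_add subspace_diff)
  moreover have "x = 0" if "x \<in> span D" and 0: "\<phi> x = 0" for x
  proof -
    have x: "x \<in> W" using that spanD by simp
    have "g (h x) = - (x - f (h x))"
      using 0 unfolding \<phi>_def by (metis add.commute add_eq_0_iff)
    then have "g (h x) \<in> K" using hK[OF x] K by (simp only: subspace_neg)
    then have "f (h x) \<in> K" using ker hV[OF x] by blast
    then have "x \<in> K" using hK[OF x] subspace_add[OF K] by fastforce
    then have "h x = 0" using x C(3) h0 by blast
    then show "x = 0" using 0 by (simp add: \<phi>_def f.zero g.zero)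
  qed
  ultimately have "span D \<subseteq> \<phi> ` span D"
    using injective_on_span_finite_imp_surjective[OF lin finD D(3)] by blast
  then obtain x where x: "x \<in> W" "w = \<phi> x" using w spanD by blast
  then have "w - g (h x) = x - f (h x)" by (simp add: \<phi>_def)
  then show ?thesis using hK[OF x(1)] hV[OF x(1)] by metis
qed

global_interpretation mscale: vector_space "mscale :: 'a::field \<Rightarrow> ('n, 'a) mpoly \<Rightarrow> _"
  by standard (rule poly_mapping_eqI, simp add: lookup_mscale lookup_add algebra_simps)+

lemma separating_functional:
  fixes V :: "('n, 'a::field) mpoly set"
  assumes "mscale.subspace V" "G \<notin> V"
  obtains \<phi> where "Vector_Spaces.linear mscale (*) \<phi>" "\<And>v. v \<in> V \<Longrightarrow> \<phi> v = 0" "\<phi> G = 1"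
proof -
  interpret vector_space_pair "mscale :: 'a \<Rightarrow> ('n, 'a) mpoly \<Rightarrow> _" "(*) :: 'a \<Rightarrow> 'a \<Rightarrow> 'a"
    by (intro vector_space_pair.intro mscale.vector_space_axioms vector_space.intro)
      (simp_all add: distrib_left distrib_right mult.assoc)
  obtain B where B: "B \<subseteq> V" "mscale.independent B" "V \<subseteq> mscale.span B"
    by (rule mscale.maximal_independent_subset)
  have span: "mscale.span B = V" using B(1,3) assms(1) by (rule mscale.span_subspace)
  have "mscale.independent (insert G B)"
    using assms(2) B(2) span by (intro mscale.independent_insertI) auto
  from linear_independent_extend[OF this, of "\<lambda>x. if x = G then 1 else 0"]
  obtain \<phi> where \<phi>: "Vector_Spaces.linear mscale (*) \<phi>"
    and eq: "\<And>x. x \<in> insert G B \<Longrightarrow> \<phi> x = (if x = G then 1 else 0)" by blast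
  interpret \<phi>: Vector_Spaces.linear mscale "(*)" \<phi> by (rule \<phi>)
  have "\<phi> v = 0" if "v \<in> V" for v
  proof -
    have "v \<in> mscale.span B" using that span by simp
    then show ?thesis
    proof (induction rule: mscale.span_induct_alt)
      case (step c x y)
      have "x \<noteq> G" using step(1) B(1) assms(2) by blast
      then show ?case using step eq[of x] by (simp add: \<phi>.add \<phi>.scale)
    qed (rule \<phi>.zero)
  qed
  with \<phi> eq[of G] show thesis by (intro that[of \<phi>]) auto
qed


section \<open>Homogeneous polynomials\<close>

lemma mdeg_add: "mdeg (a + b) = mdeg a + mdeg b"
  by (simp add: mdeg_def lookup_add sum.distrib)

lemma mdeg_single [simp]: "mdeg (Poly_Mapping.single i k) = k"
  by (simp add: mdeg_def lookup_single when_def)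

lemma mdeg_zero [simp]: "mdeg 0 = 0"
  by (simp add: mdeg_def)

lemma finite_mdeg_eq: "finite {m :: ('n::finite) monom. mdeg m = d}"
proof -
  have "Poly_Mapping.lookup m i \<le> mdeg m" for m :: "'n monom" and i
    unfolding mdeg_def by (rule member_le_sum) auto
  then have "Poly_Mapping.lookup ` {m :: 'n monom. mdeg m = d} \<subseteq> {f. \<forall>i. (i \<in> UNIV \<longrightarrow> f i \<in> {..d}) \<and> (i \<notin> UNIV \<longrightarrow> f i = 0)}"
    by auto
  then have "finite (Poly_Mapping.lookup ` {m :: 'n monom. mdeg m = d})"
    by (rule finite_subset) (intro finite_set_of_finite_funs; simp)
  then show ?thesis
    by (rule finite_imageD) (simp add: inj_on_def)
qed

lemma homogeneous_zero [simp]: "homogeneous d 0"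
  by (simp add: homogeneous_def)

lemma homogeneous_single: "homogeneous (mdeg m) (Poly_Mapping.single m c)"
  by (simp add: homogeneous_def)

lemma homogeneous_add: "homogeneous d p \<Longrightarrow> homogeneous d q \<Longrightarrow> homogeneous d (p + q)"
  using keys_add[of p q] by (auto simp: homogeneous_def)

lemma homogeneous_mult: "homogeneous d p \<Longrightarrow> homogeneous e q \<Longrightarrow> homogeneous (d + e) (p * q)"
  using keys_mult[of p q] by (fastforce simp: homogeneous_def mdeg_add)

lemma subspace_homogeneous:
  "mscale.subspace {p :: ('n::finite, 'a::field) mpoly. homogeneous d p}"
proof (rule mscale.subspaceI)
  fix c :: 'a and p :: "('n, 'a) mpoly"
  assume "p \<in> {p. homogeneous d p}"
  then show "mscale c p \<in> {p. homogeneous d p}"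
    using homogeneous_mult[OF homogeneous_single[of 0 c], of d p] by (simp add: mscale_def)
qed (simp_all add: homogeneous_add)

lemma homogeneous_subset_span:
  "{p :: ('n::finite, 'a::field) mpoly. homogeneous d p} \<subseteq>
    mscale.span ((\<lambda>m. Poly_Mapping.single m 1) ` {m. mdeg m = d})"
proof clarify
  fix p :: "('n, 'a) mpoly" assume p: "homogeneous d p"
  have "(\<Sum>m\<in>Poly_Mapping.keys p. mscale (Poly_Mapping.lookup p m) (Poly_Mapping.single m 1)) \<in>
      mscale.span ((\<lambda>m. Poly_Mapping.single m 1) ` {m. mdeg m = d})"
    using p by (intro mscale.span_sum mscale.span_scale mscale.span_base) (auto simp: homogeneous_def)
  then show "p \<in> mscale.span ((\<lambda>m. Poly_Mapping.single m 1) ` {m. mdeg m = d})"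
    by (simp add: mscale_def mult_single flip: mpoly_eq_sum_single)
qed

definition hom_part :: "nat \<Rightarrow> ('n::finite, 'a::comm_ring_1) mpoly \<Rightarrow> ('n, 'a) mpoly"
  where "hom_part d p =
    (\<Sum>m\<in>{m \<in> Poly_Mapping.keys p. mdeg m = d}. Poly_Mapping.single m (Poly_Mapping.lookup p m))"

lemma lookup_hom_part:
  "Poly_Mapping.lookup (hom_part d p) m = (Poly_Mapping.lookup p m when mdeg m = d)"
  by (auto simp: hom_part_def lookup_sum lookup_single when_def in_keys_iff)

lemma homogeneous_hom_part: "homogeneous d (hom_part d p)"
  by (auto simp: homogeneous_def in_keys_iff lookup_hom_part when_def split: if_splits)

lemma hom_part_zero [simp]: "hom_part d 0 = 0"
  by (simp add: hom_part_def)

lemma hom_part_add: "hom_part d (p + q) = hom_part d p + hom_part d q"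
  by (intro poly_mapping_eqI) (simp add: lookup_hom_part lookup_add when_add_distrib)

lemma hom_part_sum: "hom_part d (\<Sum>x\<in>X. p x) = (\<Sum>x\<in>X. hom_part d (p x))"
  by (induction X rule: infinite_finite_induct) (simp_all add: hom_part_add)

lemma hom_part_homogeneous:
  "homogeneous e p \<Longrightarrow> hom_part d p = (if e = d then p else 0)"
  by (intro poly_mapping_eqI) (auto simp: lookup_hom_part homogeneous_def in_keys_iff when_def)

lemma hom_part_mult_homogeneous:
  assumes "homogeneous e x"
  shows "hom_part d (q * x) = (if e \<le> d then hom_part (d - e) q * x else 0)"
proof -
  have "hom_part d (q * x) =
      hom_part d (\<Sum>m\<in>Poly_Mapping.keys q. Poly_Mapping.single m (Poly_Mapping.lookup q m) * x)"
    by (simp flip: sum_distrib_right mpoly_eq_sum_single)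
  also have "\<dots> = (\<Sum>m\<in>Poly_Mapping.keys q.
      if mdeg m + e = d then Poly_Mapping.single m (Poly_Mapping.lookup q m) * x else 0)"
    unfolding hom_part_sum
    by (intro sum.cong refl hom_part_homogeneous homogeneous_mult homogeneous_single assms)
  also have "\<dots> = (\<Sum>m\<in>{m \<in> Poly_Mapping.keys q. mdeg m + e = d}.
      Poly_Mapping.single m (Poly_Mapping.lookup q m) * x)"
    by (simp add: sum.inter_filter)
  also have "\<dots> = (if e \<le> d then hom_part (d - e) q * x else 0)"
  proof (cases "e \<le> d")
    case True
    then have "{m \<in> Poly_Mapping.keys q. mdeg m + e = d} = {m \<in> Poly_Mapping.keys q. mdeg m = d - e}"
      by auto
    with True show ?thesis by (simp add: hom_part_def sum_distrib_right)
  next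
    case False
    then have "{m \<in> Poly_Mapping.keys q. mdeg m + e = d} = {}" by auto
    with False show ?thesis by simp
  qed
  finally show ?thesis .
qed

lemma homogeneous_ideal_is_ideal: "homogeneous_ideal I \<Longrightarrow> is_ideal I"
  by (auto simp: homogeneous_ideal_def)

lemma homogeneous_ideal_hom_part:
  assumes "homogeneous_ideal I" "p \<in> I"
  shows "hom_part d p \<in> I"
proof -
  obtain S where S: "\<And>x. x \<in> S \<Longrightarrow> \<exists>e. homogeneous e x" and I: "I = ideal_gen S"
    using assms(1) by (auto simp: homogeneous_ideal_def)
  have "p \<in> ideal_gen S" using assms(2) I by simp
  then show ?thesis unfolding I
  proof (induction rule: ideal.span_induct_alt)
    case base
    show ?case by (simp add: ideal.span_zero)
  next
    case (step c x y)
    obtain e where "homogeneous e x" using S step(1) by blast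
    then have "hom_part d (c * x) \<in> ideal_gen S"
      using step(1) by (auto simp: hom_part_mult_homogeneous intro: ideal.span_scale ideal.span_base ideal.span_zero)
    with step(2) show ?case by (simp add: hom_part_add ideal.span_add)
  qed
qed

lemma in_ideal_gen_insert:
  "is_ideal I \<Longrightarrow> x \<in> ideal_gen (insert z I) \<longleftrightarrow> (\<exists>q. x - q * z \<in> I)"
  unfolding ideal.span_breakdown_eq by (simp only: ideal.span_eq_iff[THEN iffD2])

lemma ideal_mscale: "is_ideal J \<Longrightarrow> p \<in> J \<Longrightarrow> mscale c p \<in> J"
  unfolding mscale_def by (rule ideal.subspace_scale)

lemma mscale_subspace_ideal: "is_ideal J \<Longrightarrow> mscale.subspace J"
  by (intro mscale.subspaceI) (auto intro: ideal.subspace_0 ideal.subspace_add ideal_mscale)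

lemma linear_times: "Vector_Spaces.linear mscale mscale ((*) (z :: ('n, 'a::field) mpoly))"
  by unfold_locales (simp_all add: mscale_def algebra_simps)

lemma quot_component_vanishes_other_nonzerodiv:
  fixes I :: "('n::finite, 'a::field) mpoly set"
  assumes I: "homogeneous_ideal I"
    and z: "linear_form z" "quot_nonzerodiv I z" and w: "linear_form w"
    and vanish: "\<not> quot_component_nonzero (ideal_gen (insert w I)) (Suc d)"
  shows "\<not> quot_component_nonzero (ideal_gen (insert z I)) (Suc d)"
proof -
  note ideal = homogeneous_ideal_is_ideal[OF I]
  have onto: "\<exists>q\<in>{p. homogeneous d p}. p - w * q \<in> I" if "p \<in> {p. homogeneous (Suc d) p}" for p
  proof -
    have p: "homogeneous (Suc d) p" using that by simp
    then obtain q where "p - q * w \<in> I"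
      using vanish by (auto simp: quot_component_nonzero_def in_ideal_gen_insert[OF ideal])
    then have "hom_part (Suc d) (p + (- q) * w) \<in> I"
      using homogeneous_ideal_hom_part[OF I] by simp
    also have "hom_part (Suc d) (p + (- q) * w) = p - w * (- hom_part d (- q))"
      unfolding hom_part_add hom_part_mult_homogeneous[OF w] hom_part_homogeneous[OF p]
      by (simp add: mult.commute)
    finally have "p - w * (- hom_part d (- q)) \<in> I" .
    moreover have "homogeneous d (- hom_part d (- q))"
      using homogeneous_hom_part[of d "- q"] by (simp add: homogeneous_def)
    ultimately show ?thesis by blast
  qed
  have ker: "w * v \<in> I" if "v \<in> {p. homogeneous d p}" "z * v \<in> I" for v
    using that(2) z(2) by (intro ideal.subspace_scale[OF ideal]) (simp add: quot_nonzerodiv_def)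
  have fin: "finite ((\<lambda>m. Poly_Mapping.single m (1::'a)) ` {m :: 'n monom. mdeg m = Suc d})"
    by (simp add: finite_mdeg_eq)
  have into: "u * v \<in> {p. homogeneous (Suc d) p}"
    if "linear_form u" "v \<in> {p. homogeneous d p}" for u v :: "('n, 'a) mpoly"
    using homogeneous_mult[OF that(1), of d v] that(2) by simp
  have "\<exists>q\<in>{p. homogeneous d p}. p - z * q \<in> I" if "p \<in> {p. homogeneous (Suc d) p}" for p
    by (rule mscale.surjective_mod_subspace[OF linear_times[of w] linear_times[of z]
          subspace_homogeneous subspace_homogeneous mscale_subspace_ideal[OF ideal] fin
          homogeneous_subset_span into[OF w] into[OF z(1)] ker onto that])
  then show ?thesis
    by (auto simp: quot_component_nonzero_def in_ideal_gen_insert[OF ideal] mult.commute)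
qed


section \<open>Socles\<close>

lemma monom_eq_add_single:
  fixes m :: "('n::finite) monom"
  assumes "mdeg m > 0"
  obtains i k where "m = Poly_Mapping.single i 1 + k"
proof -
  obtain i where i: "Poly_Mapping.lookup m i \<noteq> 0"
    using assms by (force simp: mdeg_def)
  have "m = Poly_Mapping.single i 1 + (m - Poly_Mapping.single i 1)"
    using i by (intro poly_mapping_eqI) (auto simp: lookup_add lookup_minus lookup_single when_def)
  then show thesis by (rule that)
qed

lemma quot_socle_mult:
  assumes J: "is_ideal J" and f: "f \<in> quot_socle J" and t: "homogeneous e t" "e > 0"
  shows "t * f \<in> J"
proof -
  have "Poly_Mapping.single m c * f \<in> J" if "mdeg m > 0" for m c
  proof -
    obtain i k where m: "m = Poly_Mapping.single i 1 + k"
      using monom_eq_add_single[OF \<open>mdeg m > 0\<close>] by blast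
    have "Poly_Mapping.single m c * f = Poly_Mapping.single k c * (mvar i * f)"
      by (simp add: m mvar_def mult_single add.commute flip: mult.assoc)
    then show ?thesis
      using f J by (simp add: quot_socle_def ideal.subspace_scale)
  qed
  then have "(\<Sum>m\<in>Poly_Mapping.keys t. Poly_Mapping.single m (Poly_Mapping.lookup t m) * f) \<in> J"
    using t by (intro ideal.subspace_sum[OF J]) (auto simp: homogeneous_def)
  then show ?thesis by (simp flip: sum_distrib_right mpoly_eq_sum_single)
qed

lemma socle_transfer:
  assumes I: "is_ideal I" and t: "quot_nonzerodiv I t"
    and a: "a \<in> quot_socle (ideal_gen (insert t I))" and ab: "z * a - t * b \<in> I"
  shows "b \<in> quot_socle (ideal_gen (insert z I))"
  unfolding quot_socle_def
proof clarify
  fix i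
  obtain c where c: "mvar i * a - c * t \<in> I"
    using a by (auto simp: quot_socle_def in_ideal_gen_insert[OF I])
  have "z * (mvar i * a - c * t) - mvar i * (z * a - t * b) \<in> I"
    by (rule ideal.subspace_diff[OF I ideal.subspace_scale[OF I c] ideal.subspace_scale[OF I ab]])
  also have "z * (mvar i * a - c * t) - mvar i * (z * a - t * b) = t * (mvar i * b - c * z)"
    by (simp add: algebra_simps)
  finally show "mvar i * b \<in> ideal_gen (insert z I)"
    using t by (auto simp: in_ideal_gen_insert[OF I] quot_nonzerodiv_def)
qed

lemma socle_transfer_exists:
  assumes I: "is_ideal I" and a: "a \<in> quot_socle (ideal_gen (insert t I))"
    and z: "homogeneous e z" "e > 0"
  obtains b where "z * a - t * b \<in> I"
  using quot_socle_mult[OF _ a z] by (auto simp: in_ideal_gen_insert[OF I] mult.commute)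

lemma one_dim_socle_transfer:
  assumes I: "is_ideal I"
    and t: "homogeneous d t" "d > 0" "quot_nonzerodiv I t"
    and z: "homogeneous e z" "e > 0" "quot_nonzerodiv I z"
    and socle: "one_dim_socle (ideal_gen (insert t I))"
  shows "one_dim_socle (ideal_gen (insert z I))"
proof -
  obtain h where h: "h \<in> quot_socle (ideal_gen (insert t I))" "h \<notin> ideal_gen (insert t I)"
    and span: "\<And>f. f \<in> quot_socle (ideal_gen (insert t I)) \<Longrightarrow> \<exists>c. f - mscale c h \<in> ideal_gen (insert t I)"
    using socle by (auto simp: one_dim_socle_def)
  obtain b where b: "z * h - t * b \<in> I" by (rule socle_transfer_exists[OF I h(1) z(1,2)])
  have "b \<in> quot_socle (ideal_gen (insert z I))" by (rule socle_transfer[OF I t(3) h(1) b])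
  moreover have "b \<notin> ideal_gen (insert z I)"
  proof
    assume "b \<in> ideal_gen (insert z I)"
    then obtain q where "b - q * z \<in> I" by (auto simp: in_ideal_gen_insert[OF I])
    then have "(z * h - t * b) + t * (b - q * z) \<in> I"
      using b by (intro ideal.subspace_add[OF I] ideal.subspace_scale[OF I])
    also have "(z * h - t * b) + t * (b - q * z) = z * (h - q * t)" by (simp add: algebra_simps)
    finally show False
      using z(3) h(2) by (auto simp: in_ideal_gen_insert[OF I] quot_nonzerodiv_def)
  qed
  moreover have "\<exists>c. f - mscale c b \<in> ideal_gen (insert z I)"
    if f: "f \<in> quot_socle (ideal_gen (insert z I))" for f
  proof -
    obtain g where g: "t * f - z * g \<in> I" by (rule socle_transfer_exists[OF I f t(1,2)])
    obtain c q where cq: "g - mscale c h - q * t \<in> I"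
      using span[OF socle_transfer[OF I z(3) f g]] by (auto simp: in_ideal_gen_insert[OF I])
    have "(t * f - z * g) + z * (g - mscale c h - q * t) + mscale c (z * h - t * b) \<in> I"
      using g cq b by (intro ideal.subspace_add[OF I] ideal.subspace_scale[OF I] ideal_mscale[OF I])
    also have "(t * f - z * g) + z * (g - mscale c h - q * t) + mscale c (z * h - t * b) =
        t * (f - mscale c b - q * z)"
      by (simp add: mscale_def algebra_simps)
    finally show ?thesis
      using t(3) by (auto simp: in_ideal_gen_insert[OF I] quot_nonzerodiv_def)
  qed
  ultimately show ?thesis by (auto simp: one_dim_socle_def)
qed

lemma quot_gorenstein_dim_one_socle:
  assumes I: "is_ideal I" and "quot_krull_dim I 1" "quot_gorenstein I"
    and z: "linear_form z" "quot_nonzerodiv I z"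
  shows "one_dim_socle (ideal_gen (insert z I))"
proof -
  obtain ts where ts: "quot_krull_dim I (length ts)" "quot_regular_seq I ts"
      "\<forall>t\<in>set ts. \<exists>e>0. homogeneous e t" "one_dim_socle (ideal_gen (I \<union> set ts))"
    using assms(3) by (auto simp: quot_gorenstein_def)
  have "length ts = 1"
    using ts(1) assms(2) by (auto simp: quot_krull_dim_def intro!: antisym)
  then obtain t where t: "ts = [t]" by (auto simp: length_Suc_conv)
  have "quot_nonzerodiv I t"
    using ts(2) ideal.span_eq_iff[THEN iffD2, OF I] by (simp add: t quot_regular_seq_def)
  moreover obtain e where "e > 0" "homogeneous e t" using ts(3) t by auto
  moreover have "one_dim_socle (ideal_gen (insert t I))" using ts(4) by (simp add: t)
  ultimately show ?thesis
    using one_dim_socle_transfer[OF I, of e t 1 z] z by simp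
qed

lemma socle_multiple_exists:
  fixes J :: "('n::finite, 'a::field) mpoly set"
  assumes J: "is_ideal J" and high: "\<And>d. d > s \<Longrightarrow> \<not> quot_component_nonzero J d"
    and f: "f \<notin> J"
  obtains r where "r * f \<in> quot_socle J" "r * f \<notin> J"
proof -
  let ?P = "\<lambda>d. \<exists>m. mdeg m = d \<and> Poly_Mapping.single m 1 * f \<notin> J"
  have "?P 0" using f by (intro exI[of _ 0]) simp
  moreover have bound: "\<And>d. ?P d \<Longrightarrow> d \<le> s"
  proof -
    fix d assume "?P d"
    then obtain m where m: "mdeg m = d" "Poly_Mapping.single m 1 * f \<notin> J" by blast
    then have "Poly_Mapping.single m 1 \<notin> J"
      using ideal.subspace_scale[OF J, of _ f] by (metis mult.commute)
    then have "quot_component_nonzero J d"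
      using homogeneous_single[of m 1] m(1) by (auto simp: quot_component_nonzero_def)
    then show "d \<le> s" using high by (meson not_le)
  qed
  ultimately have "?P (Greatest ?P)" using GreatestI_nat[of ?P 0 s] by blast
  then obtain m where m: "mdeg m = Greatest ?P" "Poly_Mapping.single m 1 * f \<notin> J" by blast
  have "mvar i * (Poly_Mapping.single m 1 * f) \<in> J" for i
  proof (rule ccontr)
    let ?k = "Poly_Mapping.single i 1 + m"
    assume "mvar i * (Poly_Mapping.single m 1 * f) \<notin> J"
    then have "Poly_Mapping.single ?k 1 * f \<notin> J"
      by (simp add: mvar_def mult_single flip: mult.assoc)
    then have "?P (mdeg ?k)" by blast
    then have "mdeg ?k \<le> Greatest ?P" using bound Greatest_le_nat[of ?P "mdeg ?k" s] by blast
    then show False by (simp add: mdeg_add m(1))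
  qed
  then show thesis using m(2) by (intro that[of "Poly_Mapping.single m 1"]) (auto simp: quot_socle_def)
qed


section \<open>Duality\<close>

lemma lookup_monom_deriv_zero:
  fixes g :: "('n::finite, 'a::field_char_0) mpoly"
  shows "Poly_Mapping.lookup (monom_deriv a g) 0 =
    of_nat (\<Prod>i\<in>UNIV. fact (Poly_Mapping.lookup a i)) * Poly_Mapping.lookup g a"
  by (simp add: lookup_monom_deriv pochhammer_fact[symmetric])

lemma dact_lookup_zero_separates:
  fixes g :: "('n::finite, 'a::field_char_0) mpoly"
  assumes "\<And>r. Poly_Mapping.lookup (r \<odot> g) 0 = 0"
  shows "g = 0"
proof (rule poly_mapping_eqI)
  fix a
  show "Poly_Mapping.lookup g a = Poly_Mapping.lookup 0 a"
    using assms[of "Poly_Mapping.single a 1"]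
    by (simp add: dact_single lookup_mscale lookup_monom_deriv_zero)
qed

lemma linear_form_dact_lowers_degree:
  fixes z :: "('n::finite, 'a::comm_ring_1) mpoly"
  assumes z: "linear_form z" and g: "\<And>m. mdeg m \<ge> Suc d \<Longrightarrow> Poly_Mapping.lookup g m = 0"
    and m: "mdeg m \<ge> d"
  shows "Poly_Mapping.lookup (z \<odot> g) m = 0"
  unfolding lookup_dact[OF finite_keys order.refl]
proof (intro sum.neutral ballI)
  fix a assume "a \<in> Poly_Mapping.keys z"
  then have "mdeg (m + a) \<ge> Suc d" using z m by (simp add: homogeneous_def mdeg_add)
  then show "Poly_Mapping.lookup z a * Poly_Mapping.lookup (monom_deriv a g) m = 0"
    by (simp add: lookup_monom_deriv g)
qed

lemma linear_form_power_kills: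
  fixes z :: "('n::finite, 'a::comm_ring_1) mpoly"
  assumes z: "linear_form z"
  obtains d where "z ^ d \<odot> g = 0"
proof -
  have "z ^ d \<odot> g = 0" if "\<And>m. mdeg m \<ge> d \<Longrightarrow> Poly_Mapping.lookup g m = 0" for d
    using that
  proof (induction d arbitrary: g)
    case 0
    then show ?case by (simp add: dact_one poly_mapping_eqI)
  next
    case (Suc d)
    have "z ^ d \<odot> (z \<odot> g) = 0"
      using linear_form_dact_lowers_degree[OF z Suc.prems] by (intro Suc.IH) blast
    then show ?case by (simp add: dact_dact mult.commute)
  qed
  moreover have "Poly_Mapping.lookup g m = 0" if "mdeg m \<ge> Suc (Max (mdeg ` Poly_Mapping.keys g))" for m
  proof (rule ccontr)
    assume "Poly_Mapping.lookup g m \<noteq> 0"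
    then have "mdeg m \<le> Max (mdeg ` Poly_Mapping.keys g)"
      by (intro Max_ge) (auto simp: in_keys_iff)
    then show False using that by simp
  qed
  ultimately show thesis using that by blast
qed

lemma mscale_dact: "mscale c (f \<odot> g) = mscale c f \<odot> g"
proof -
  have "mscale c p = Poly_Mapping.single 0 c \<odot> p" for p :: "('a, 'b) mpoly"
    by (simp add: dact_single poly_mapping_eqI lookup_mscale lookup_monom_deriv)
  then show ?thesis by (simp add: dact_dact mscale_def)
qed

lemma in_submodule_gen_singleton: "g \<in> submodule_gen {h} \<longleftrightarrow> (\<exists>r. g = r \<odot> h)"
  by (auto simp: dact.span_singleton)

lemma inverse_system_Ann_singleton:
  fixes h :: "('n::finite, 'a::field_char_0) mpoly"
  assumes ann: "\<And>f. f \<odot> h = 0 \<Longrightarrow> f \<odot> g = 0"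
  shows "g \<in> submodule_gen {h}"
proof (rule ccontr)
  assume g: "g \<notin> submodule_gen {h}"
  have "mscale.subspace (submodule_gen {h})"
  proof (rule mscale.subspaceI)
    fix c p assume "p \<in> submodule_gen {h}"
    then show "mscale c p \<in> submodule_gen {h}"
      unfolding in_submodule_gen_singleton by (metis mscale_dact)
  qed (auto intro: dact.span_zero dact.span_add)
  then obtain \<phi> where \<phi>: "Vector_Spaces.linear mscale (*) \<phi>"
    and \<phi>0: "\<And>v. v \<in> submodule_gen {h} \<Longrightarrow> \<phi> v = 0" and \<phi>1: "\<phi> g = 1"
    using g by (rule separating_functional) blast
  interpret \<phi>: Vector_Spaces.linear mscale "(*)" \<phi> by (rule \<phi>)
  have expand: "\<phi> p = (\<Sum>a\<in>Poly_Mapping.keys p. Poly_Mapping.lookup p a * \<phi> (Poly_Mapping.single a 1))" for p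
  proof -
    have "p = (\<Sum>a\<in>Poly_Mapping.keys p. mscale (Poly_Mapping.lookup p a) (Poly_Mapping.single a 1))"
      by (simp add: mscale_def mult_single flip: mpoly_eq_sum_single)
    then have "\<phi> p = \<phi> (\<Sum>a\<in>Poly_Mapping.keys p. mscale (Poly_Mapping.lookup p a) (Poly_Mapping.single a 1))"
      by simp
    then show ?thesis by (simp only: \<phi>.sum \<phi>.scale)
  qed
  let ?fact = "\<lambda>a :: 'n monom. of_nat (\<Prod>i\<in>UNIV. fact (Poly_Mapping.lookup a i)) :: 'a"
  have fact: "?fact a \<noteq> 0" for a by simp
  obtain N where N: "\<And>a. a \<in> Poly_Mapping.keys g \<union> Poly_Mapping.keys h \<Longrightarrow> mdeg a \<le> N"
  proof -
    have "finite (mdeg ` (Poly_Mapping.keys g \<union> Poly_Mapping.keys h))" by simp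
    then show thesis using that by (metis Max_ge imageI)
  qed
  let ?K = "{a :: 'n monom. mdeg a \<le> N}"
  have finK: "finite ?K"
  proof -
    have "?K = (\<Union>d\<in>{..N}. {a. mdeg a = d})" by auto
    then show ?thesis by (simp add: finite_mdeg_eq)
  qed
  \<comment> \<open>\<open>f\<close> represents \<open>\<phi>\<close> in degrees up to \<open>N\<close> under the pairing \<open>(f \<circ> p)(0)\<close>.\<close>
  define f where "f = (\<Sum>a\<in>?K. Poly_Mapping.single a (\<phi> (Poly_Mapping.single a 1) / ?fact a))"
  have lookup_f: "Poly_Mapping.lookup (f \<odot> p) 0 = \<phi> p" if "Poly_Mapping.keys p \<subseteq> ?K" for p
  proof -
    have "Poly_Mapping.lookup (f \<odot> p) 0 = (\<Sum>a\<in>?K. Poly_Mapping.lookup p a * \<phi> (Poly_Mapping.single a 1))"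
      using fact by (simp add: f_def dact_sum_left dact_single lookup_sum lookup_mscale lookup_monom_deriv_zero mult.commute)
    also have "\<dots> = \<phi> p"
      unfolding expand[of p] using that finK by (intro sum.mono_neutral_right) (auto simp: in_keys_iff)
    finally show ?thesis .
  qed
  have keys_dact: "Poly_Mapping.keys (r \<odot> h) \<subseteq> ?K" for r
  proof
    fix m assume "m \<in> Poly_Mapping.keys (r \<odot> h)"
    then have "(\<Sum>a\<in>Poly_Mapping.keys r. Poly_Mapping.lookup r a * Poly_Mapping.lookup (monom_deriv a h) m) \<noteq> 0"
      by (simp add: in_keys_iff lookup_dact[OF finite_keys order.refl])
    then obtain a where "Poly_Mapping.lookup (monom_deriv a h) m \<noteq> 0"
      by (metis (no_types, lifting) mult_zero_right sum.neutral)
    then have "m + a \<in> Poly_Mapping.keys h" by (auto simp: lookup_monom_deriv in_keys_iff)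
    then have "mdeg (m + a) \<le> N" using N by blast
    then show "m \<in> ?K" by (simp add: mdeg_add)
  qed
  have "f \<odot> h = 0"
  proof (rule dact_lookup_zero_separates)
    fix r
    have "r \<odot> (f \<odot> h) = f \<odot> (r \<odot> h)" by (simp add: dact_dact mult.commute)
    moreover have "\<phi> (r \<odot> h) = 0"
      by (rule \<phi>0) (auto simp: in_submodule_gen_singleton)
    ultimately show "Poly_Mapping.lookup (r \<odot> (f \<odot> h)) 0 = 0"
      using lookup_f[OF keys_dact] by simp
  qed
  then have "f \<odot> g = 0" by (rule ann)
  moreover have "Poly_Mapping.lookup (f \<odot> g) 0 = 1"
    using lookup_f[of g] N \<phi>1 by auto
  ultimately show False by simp
qed

lemma Ann_of_top_degree_element:
  fixes J :: "('n::finite, 'a::field_char_0) mpoly set"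
  assumes J: "is_ideal J" and high: "\<And>d. d > s \<Longrightarrow> \<not> quot_component_nonzero J d"
    and socle: "one_dim_socle J"
    and g: "has_degree g s" "g \<in> inverse_system J"
    and fg: "f \<odot> g = 0"
  shows "f \<in> J"
proof (rule ccontr)
  assume "f \<notin> J"
  then obtain r where r: "r * f \<in> quot_socle J" "r * f \<notin> J"
    using socle_multiple_exists[OF J high] by blast
  have Jg: "p \<odot> g = 0" if "p \<in> J" for p using that g(2) by (auto simp: inverse_system_def)
  obtain h where h: "\<And>f. f \<in> quot_socle J \<Longrightarrow> \<exists>c. f - mscale c h \<in> J"
    using socle by (auto simp: one_dim_socle_def)
  obtain c where c: "r * f - mscale c h \<in> J" using h[OF r(1)] by blast
  have "c \<noteq> 0" using c r(2) by (auto simp: mscale_def)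
  have "(r * f - mscale c h) \<odot> g = 0" using c by (rule Jg)
  moreover have "(r * f) \<odot> g = 0" by (simp add: fg flip: dact_dact)
  ultimately have "mscale c (h \<odot> g) = 0" by (simp add: dact.scale_left_diff_distrib mscale_dact)
  then have hg: "h \<odot> g = 0" using \<open>c \<noteq> 0\<close> by (simp add: mscale.scale_eq_0_iff)
  obtain m where m: "m \<in> Poly_Mapping.keys g" "mdeg m = s"
    using g(1) by (auto simp: has_degree_def)
  let ?x = "Poly_Mapping.single m (1::'a)"
  have "mvar i * ?x \<in> J" for i
  proof -
    have "homogeneous (Suc s) (mvar i * ?x)"
      using homogeneous_single[of "Poly_Mapping.single i 1 + m" "1::'a"]
      by (simp add: mvar_def mult_single mdeg_add m(2))
    then show ?thesis using high[of "Suc s"] by (auto simp: quot_component_nonzero_def)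
  qed
  then have "?x \<in> quot_socle J" by (simp add: quot_socle_def)
  then obtain b where "?x - mscale b h \<in> J" using h by blast
  then have "(?x - mscale b h) \<odot> g = 0" by (rule Jg)
  then have "?x \<odot> g = 0" by (simp add: dact.scale_left_diff_distrib hg flip: mscale_dact)
  then have "Poly_Mapping.lookup (?x \<odot> g) 0 = 0" by simp
  then show False
    using m(1) by (simp add: dact_single lookup_mscale lookup_monom_deriv_zero in_keys_iff)
qed


section \<open>The tower over the first generator\<close>

context
  fixes I :: "('n::finite, 'a::field_char_0) mpoly set" and z :: "('n, 'a) mpoly"
    and F :: "nat \<Rightarrow> ('n, 'a) mpoly"
  assumes I: "is_ideal I"
    and F: "\<And>l. l \<ge> 1 \<Longrightarrow> F l \<in> inverse_system I"
    and step: "\<And>l. l > 1 \<Longrightarrow> z \<odot> F l = F (l - 1)" and first: "z \<odot> F 1 = 0"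
    and Ann_first: "\<And>f. f \<odot> F 1 = 0 \<Longrightarrow> f \<in> ideal_gen (insert z I)"
begin

lemma tower_kills: "l \<ge> 1 \<Longrightarrow> f \<in> I \<Longrightarrow> f \<odot> F l = 0"
  using F by (auto simp: inverse_system_def)

lemma tower_power_shift: "z ^ l \<odot> F (Suc l) = F 1"
proof (induction l)
  case (Suc l)
  have "z ^ Suc l \<odot> F (Suc (Suc l)) = z ^ l \<odot> (z \<odot> F (Suc (Suc l)))"
    by (simp add: dact_dact mult.commute)
  then show ?case using Suc step[of "Suc (Suc l)"] by simp
qed (simp add: dact_one)

lemma tower_Ann:
  assumes "f \<odot> F (Suc l) = 0"
  obtains q where "f - q * z ^ Suc l \<in> I"
  using assms
proof (induction l arbitrary: f thesis)
  case 0
  then show ?case using Ann_first[of f] by (auto simp: in_ideal_gen_insert[OF I])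
next
  case (Suc l)
  have "f \<odot> F (Suc l) = f \<odot> (z \<odot> F (Suc (Suc l)))"
    using step[of "Suc (Suc l)"] by simp
  also have "\<dots> = z \<odot> (f \<odot> F (Suc (Suc l)))" by (simp add: dact_dact mult.commute)
  finally obtain q where q: "f - q * z ^ Suc l \<in> I"
    using Suc.IH Suc.prems(2) by auto
  have "q \<odot> F 1 = (q * z ^ Suc l) \<odot> F (Suc (Suc l))"
    using tower_power_shift[of "Suc l"] by (simp flip: dact_dact)
  also have "\<dots> = f \<odot> F (Suc (Suc l)) - (f - q * z ^ Suc l) \<odot> F (Suc (Suc l))"
    by (simp add: dact.scale_left_diff_distrib)
  also have "\<dots> = 0" using Suc.prems(2) tower_kills[OF _ q] by simp
  finally obtain p where p: "q - p * z \<in> I"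
    using Ann_first[of q] by (auto simp: in_ideal_gen_insert[OF I])
  have "(f - q * z ^ Suc l) + z ^ Suc l * (q - p * z) \<in> I"
    using q p by (intro ideal.subspace_add[OF I] ideal.subspace_scale[OF I])
  then have "f - p * z ^ Suc (Suc l) \<in> I" by (simp add: algebra_simps)
  then show ?case by (rule Suc.prems(1))
qed

lemma tower_Ann_image:
  assumes "l \<ge> 1"
  shows "(\<lambda>g. g \<odot> F (l + 1)) ` Ann (submodule_gen {F l}) = submodule_gen {F 1}"
proof -
  obtain k where l: "l = Suc k" using assms by (cases l) auto
  have shift: "(q * z ^ l) \<odot> F (l + 1) = q \<odot> F 1" for q
    using tower_power_shift[of l] by (simp flip: dact_dact)
  have "\<exists>q. f \<odot> F (l + 1) = q \<odot> F 1" if "f \<in> Ann (submodule_gen {F l})" for f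
  proof -
    have "f \<odot> F (Suc k) = 0"
      using that dact.span_base[of "F l" "{F l}"] by (auto simp: Ann_def l)
    then obtain q where "f - q * z ^ l \<in> I" using tower_Ann l by blast
    then have "(f - q * z ^ l) \<odot> F (l + 1) = 0" by (intro tower_kills) auto
    then show ?thesis using shift by (auto simp: dact.scale_left_diff_distrib)
  qed
  moreover have "q * z ^ l \<in> Ann (submodule_gen {F l})" for q
  proof -
    have "(q * z ^ l) \<odot> (r \<odot> F l) = (q * r * z) \<odot> (z ^ k \<odot> F (Suc k))" for r
      by (simp add: l dact_dact mult_ac)
    then have "(q * z ^ l) \<odot> (r \<odot> F l) = 0" for r
      using first by (simp add: tower_power_shift flip: dact_dact)
    then show ?thesis by (auto simp: Ann_def in_submodule_gen_singleton)
  qed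
  ultimately show ?thesis
    unfolding set_eq_iff in_submodule_gen_singleton image_iff using shift by metis
qed

lemma tower_inverse_system:
  assumes "g \<in> inverse_system I" "z ^ Suc l \<odot> g = 0"
  shows "g \<in> submodule_gen {F (Suc l)}"
  using assms
proof (induction l arbitrary: g)
  case 0
  have "g \<in> submodule_gen {F 1}"
  proof (rule inverse_system_Ann_singleton)
    fix f assume "f \<odot> F 1 = 0"
    then obtain q where "f - q * z \<in> I" using Ann_first[of f] by (auto simp: in_ideal_gen_insert[OF I])
    then have "(f - q * z) \<odot> g = 0" using 0(1) by (simp add: inverse_system_def)
    moreover have "(q * z) \<odot> g = 0" using 0(2) by (simp flip: dact_dact)
    ultimately show "f \<odot> g = 0" by (simp add: dact.scale_left_diff_distrib)
  qed
  then show ?case by simp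
next
  case (Suc l)
  have inv: "p \<odot> g \<in> inverse_system I" if "g \<in> inverse_system I" for p g
  proof -
    have "f \<odot> (p \<odot> g) = p \<odot> (f \<odot> g)" for f by (simp add: dact_dact mult.commute)
    then show ?thesis using that by (simp add: inverse_system_def)
  qed
  have "z \<odot> g \<in> submodule_gen {F (Suc l)}"
    using Suc.prems by (intro Suc.IH inv) (simp_all add: dact_dact mult_ac)
  then obtain r where r: "z \<odot> g = r \<odot> F (Suc l)" by (auto simp: in_submodule_gen_singleton)
  have "z \<odot> (g - r \<odot> F (Suc (Suc l))) = z \<odot> g - r \<odot> (z \<odot> F (Suc (Suc l)))"
    by (simp add: dact.scale_right_diff_distrib dact_dact mult.commute)
  also have "\<dots> = 0" using r step[of "Suc (Suc l)"] by simp
  finally have 0: "z \<odot> (g - r \<odot> F (Suc (Suc l))) = 0" .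
  have "g - r \<odot> F (Suc (Suc l)) \<in> inverse_system I"
    using Suc.prems(1) inv[OF F[of "Suc (Suc l)"], of r]
    by (simp add: inverse_system_def dact.scale_right_diff_distrib)
  then have "g - r \<odot> F (Suc (Suc l)) \<in> submodule_gen {F (Suc l)}"
    using 0 by (intro Suc.IH) (simp_all add: mult.commute[of z] flip: dact_dact)
  then obtain p where "g - r \<odot> F (Suc (Suc l)) = p \<odot> F (Suc l)"
    by (auto simp: in_submodule_gen_singleton)
  then have "g = r \<odot> F (Suc (Suc l)) + p \<odot> (z \<odot> F (Suc (Suc l)))"
    using step[of "Suc (Suc l)"] by (simp add: algebra_simps)
  then have "g = (r + p * z) \<odot> F (Suc (Suc l))" by (simp add: dact_add_left dact_dact)
  then show ?case by (auto simp: in_submodule_gen_singleton)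
qed

lemma tower_generates:
  assumes z: "linear_form z"
  shows "submodule_gen (F ` {1..}) = inverse_system I"
proof
  have "dact.subspace (inverse_system I)"
  proof (rule dact.subspaceI)
    fix p g assume "g \<in> inverse_system I"
    moreover have "f \<odot> (p \<odot> g) = p \<odot> (f \<odot> g)" for f by (simp add: dact_dact mult.commute)
    ultimately show "p \<odot> g \<in> inverse_system I" by (simp add: inverse_system_def)
  qed (auto simp: inverse_system_def dact_add_right)
  then show "submodule_gen (F ` {1..}) \<subseteq> inverse_system I"
    using F by (intro dact.span_minimal) auto
  show "inverse_system I \<subseteq> submodule_gen (F ` {1..})"
  proof
    fix g assume g: "g \<in> inverse_system I"
    obtain d where "z ^ d \<odot> g = 0" using linear_form_power_kills[OF z] .
    then have "z ^ Suc d \<odot> g = 0" by (simp flip: dact_dact)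
    then have "g \<in> submodule_gen {F (Suc d)}" using g by (rule tower_inverse_system[rotated])
    also have "\<dots> \<subseteq> submodule_gen (F ` {1..})" by (rule dact.span_mono) auto
    finally show "g \<in> submodule_gen (F ` {1..})" .
  qed
qed

end

theorem proposition2p3:
  fixes I :: "('n::finite, 'k::{alg_closed_field, field_char_0}) mpoly set"
    and z :: "('n, 'k) mpoly"
    and F :: "nat \<Rightarrow> ('n, 'k) mpoly"
    and s :: nat
  assumes "homogeneous_ideal I"
    and "quot_krull_dim I 1"
    and "quot_gorenstein I"
    and "\<And>l. l \<ge> 1 \<Longrightarrow> F l \<in> inverse_system I"
    and "linear_form z"
    and "quot_nonzerodiv I z"
    and "\<And>l. l > 1 \<Longrightarrow> z \<odot> F l = F (l - 1)"
    and "z \<odot> F 1 = 0"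
    and "is_socle_degree I s"
    and "has_degree (F 1) s"
  shows "\<exists>\<alpha> :: nat \<Rightarrow> 'k.
    (\<forall>l\<ge>1. \<alpha> l \<noteq> 0) \<and>
    G_admissible z (\<lambda>l. mscale (1 / \<alpha> l) (F l)) \<and>
    submodule_gen (F ` {1..}) = inverse_system I \<and>
    submodule_gen ((\<lambda>l. mscale (1 / \<alpha> l) (F l)) ` {1..}) = inverse_system I"
proof -
  let ?J = "ideal_gen (insert z I)"
  note I = homogeneous_ideal_is_ideal[OF assms(1)]
  obtain w where w: "linear_form w"
    and vanish: "\<And>t. quot_component_nonzero (ideal_gen (insert w I)) t \<Longrightarrow> t \<le> s"
    using assms(9) by (auto simp: is_socle_degree_def)
  have high: "\<not> quot_component_nonzero ?J d" if "d > s" for d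
  proof (cases d)
    case (Suc k)
    have "\<not> quot_component_nonzero (ideal_gen (insert w I)) (Suc k)"
      using vanish[of d] that Suc by auto
    then show ?thesis
      unfolding Suc by (rule quot_component_vanishes_other_nonzerodiv[OF assms(1,5,6) w])
  qed (use that in simp)
  have "F 1 \<in> inverse_system ?J"
  proof -
    have "f \<odot> F 1 = 0" if f: "f \<in> ?J" for f
    proof -
      obtain q where "f - q * z \<in> I" using f by (auto simp: in_ideal_gen_insert[OF I])
      then have "(f - q * z) \<odot> F 1 = 0" using assms(4)[of 1] by (simp add: inverse_system_def)
      moreover have "(q * z) \<odot> F 1 = 0" using assms(8) by (simp flip: dact_dact)
      ultimately show ?thesis by (simp add: dact.scale_left_diff_distrib)
    qed
    then show ?thesis by (simp add: inverse_system_def)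
  qed
  then have Ann: "f \<in> ?J" if "f \<odot> F 1 = 0" for f
    using that Ann_of_top_degree_element[OF ideal.subspace_span high
        quot_gorenstein_dim_one_socle[OF I assms(2,3,5,6)] assms(10)] by blast
  note tower = I assms(4,7,8) Ann
  have "submodule_gen (F ` {1..}) = inverse_system I"
    by (rule tower_generates[OF tower assms(5)])
  moreover have "G_admissible z F"
    using assms(7,8) tower_Ann_image[OF tower] by (simp add: G_admissible_def)
  moreover have "mscale (1 / 1) p = p" for p :: "('n, 'k) mpoly" by simp
  ultimately show ?thesis by (intro exI[of _ "\<lambda>_. 1"]) simp
qed

end
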